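(* Let $\rho\in(0,1)$ be irrational. The convex set $\Lambda_\rho\subset\mathbf{R}^2$ has infinitely many extremal points. Moreover, there are exactly two accumulation points of the set of extremal points of $\Lambda_\rho$, namely $(0,\rho)$ and $(\rho,0)$.
   Context: Let $\mathbf{N}=\{0,1,2,\dots\}$, and let $\lceil x\rceil$ denote the smallest integer $\ge x$. For irrational $\rho\in(0,1)$ and $m,n\in\mathbf{N}$ put $\alpha_n:=\lceil n\rho\rceil-n\rho$ and $$\rho_{m,n}:=\frac{(\lceil m\rho\rceil,\lceil n\rho\rceil)}{m+n+1}\in\mathbf{R}^2 .$$ Then $\Lambda_\rho$ is the closed convex hull in $\mathbf{R}^2$ of the set $\{0\}\cup\{\rho_{m,n}: m,n\in\mathbf{N},\ \alpha_m<\rho,\ \alpha_n<\rho\}$. Extremal points are extreme points in the usual sense of convex geometry. *)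

theory Defs
  imports "HOL-Analysis.Analysis"
begin

definition alpha :: "real \<Rightarrow> nat \<Rightarrow> real" where
  "alpha \<rho> n = of_int \<lceil>real n * \<rho>\<rceil> - real n * \<rho>"

(* R^2 is the type real * real, whose norm in HOL-Analysis is the Euclidean one. *)
definition rho_pt :: "real \<Rightarrow> nat \<Rightarrow> nat \<Rightarrow> real \<times> real" where
  "rho_pt \<rho> m n =
     (of_int \<lceil>real m * \<rho>\<rceil> / real (m + n + 1), of_int \<lceil>real n * \<rho>\<rceil> / real (m + n + 1))"

definition Lambda :: "real \<Rightarrow> (real \<times> real) set" where
  "Lambda \<rho> =
     closure (convex hull (insert 0 {rho_pt \<rho> m n |m n. alpha \<rho> m < \<rho> \<and> alpha \<rho> n < \<rho>}))"

end

theory Submission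
  imports Defs
begin

text \<open>
  Write \<open>a n = \<lceil>n \<rho>\<rceil> = n \<rho> + alpha n\<close>. For \<open>(x, y) = rho_pt m n\<close> this gives
  \<open>x + y - \<rho> = (alpha m + alpha n - \<rho>) / (m + n + 1)\<close>, a quantity of modulus at most
  \<open>\<rho> / (m + n + 1)\<close> for a generating point. So the generating points accumulate only on the
  segment \<open>x + y = \<rho>\<close> of the positive quadrant. Extreme points of \<open>Lambda\<close> lie in the
  closure of the generating points, so they too accumulate only there.

  The open segment contains none of these accumulation points: the values of \<open>alpha\<close> below
  \<open>\<rho>\<close> come arbitrarily close to \<open>\<rho>\<close> (Kronecker), so some diagonal point \<open>rho_pt m m\<close>
  lies strictly beyond the segment, which places the open segment inside the interior of
  \<open>Lambda\<close> (\<open>interior_convex_beyond_segment\<close>). Extreme points avoid that open set.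

  That the end \<open>(\<rho>, 0)\<close> is an accumulation point comes from a supremum that is not attained.
  Seen from this end, a generating point off the \<open>x\<close>-axis satisfies
  \<open>x + y - \<rho> = slope m n * y\<close> with \<open>slope m n = (alpha m + alpha n - \<rho>) / a n\<close>. These slopes
  are bounded, but none is the largest, since for fixed \<open>n\<close> one can always increase
  \<open>alpha m\<close> towards \<open>\<rho>\<close> (\<open>slope_sup\<close>). If \<open>\<sigma>\<close> is their supremum, the line
  \<open>x + y - \<rho> = \<sigma> y\<close> supports \<open>Lambda\<close> at \<open>(\<rho>, 0)\<close>, and it touches the closure of the
  generating points there only. If the extreme points stayed away from \<open>(\<rho>, 0)\<close>, compactness
  would leave room to tilt this line a little about \<open>(\<rho>, 0)\<close> into \<open>Lambda\<close> while keeping all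
  extreme points, hence all of \<open>Lambda\<close>, on one side. That would bound the slopes by a number
  below \<open>\<sigma>\<close>. The lemma \<open>islimpt_extreme_points_by_tilting\<close> is this argument for general
  compact sets. Exchanging the coordinates settles the other end, and a set with an
  accumulation point is infinite.
\<close>

section \<open>Extreme points accumulating at a tilted support point\<close>

text \<open>
  If the extreme points other than \<open>v\<close> kept a distance from \<open>v\<close>, the functional \<open>a\<close> would stay
  below \<open>c\<close> by a fixed margin on all of them, so adding a small multiple of \<open>b\<close> would still
  leave every extreme point, and by Krein and Milman every point of the hull, in the half-space of
  level \<open>c\<close>. The hypothesis \<open>tilt\<close> says that no such multiple exists.
\<close>

lemma islimpt_extreme_points_by_tilting:
  fixes C :: "'a::euclidean_space set"
  assumes "compact C"
    and strict: "\<And>x. x \<in> C \<Longrightarrow> x \<noteq> v \<Longrightarrow> a \<bullet> x < c"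
    and pivot: "a \<bullet> v \<le> c" "b \<bullet> v \<le> 0"
    and tilt: "\<And>\<eta>. 0 < \<eta> \<Longrightarrow> \<exists>x\<in>C. c < (a + \<eta> *\<^sub>R b) \<bullet> x"
  shows "v islimpt {x. x extreme_point_of (convex hull C)}"
proof (rule ccontr)
  assume "\<not> ?thesis"
  then obtain T where T: "v \<in> T" "open T"
    and isolated: "\<And>x. x extreme_point_of (convex hull C) \<Longrightarrow> x \<in> T \<Longrightarrow> x = v"
    by (auto simp: islimpt_def)
  have "compact (insert 0 ((\<lambda>x. b \<bullet> x) ` C))"
    using \<open>compact C\<close> by (intro compact_insert compact_continuous_image continuous_intros)
  then obtain B where B: "B > 0" "\<And>x. x \<in> C \<Longrightarrow> \<bar>b \<bullet> x\<bar> \<le> B"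
    by (fastforce dest: compact_imp_bounded simp: bounded_pos)
  \<comment> \<open>Adding c - 1 keeps the compact set of values nonempty when T covers C.\<close>
  have "compact (insert (c - 1) ((\<lambda>x. a \<bullet> x) ` (C - T)))"
    using \<open>compact C\<close> T
    by (intro compact_insert compact_continuous_image continuous_intros compact_diff)
  then obtain s where s: "s \<in> insert (c - 1) ((\<lambda>x. a \<bullet> x) ` (C - T))"
      "\<And>x. x \<in> C - T \<Longrightarrow> a \<bullet> x \<le> s"
    using compact_attains_sup[of "insert (c - 1) ((\<lambda>x. a \<bullet> x) ` (C - T))"] by auto
  have "s < c"
    using s(1) strict T by auto
  define \<eta> where "\<eta> = (c - s) / B"
  have "\<eta> > 0"
    using \<open>s < c\<close> B by (simp add: \<eta>_def)
  have ext: "(a + \<eta> *\<^sub>R b) \<bullet> x \<le> c" if x: "x extreme_point_of (convex hull C)" for x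
  proof (cases "x \<in> T")
    case True
    then have "x = v"
      using isolated x by blast
    then show ?thesis
      using pivot \<open>\<eta> > 0\<close> by (simp add: inner_add_left add_nonpos_nonpos mult_nonneg_nonpos
          add_decreasing2)
  next
    case False
    then have "x \<in> C - T"
      using extreme_point_of_convex_hull x by blast
    then have "a \<bullet> x \<le> s" "\<eta> * (b \<bullet> x) \<le> \<eta> * B"
      using s(2) B(2)[of x] \<open>\<eta> > 0\<close> by (auto intro!: mult_left_mono)
    then show ?thesis
      using B by (simp add: inner_add_left \<eta>_def)
  qed
  have "C \<subseteq> convex hull {x. x extreme_point_of (convex hull C)}"
    using Krein_Milman_Minkowski[of "convex hull C"] \<open>compact C\<close> hull_subset[of C convex]
    by (simp add: compact_convex_hull)
  also have "\<dots> \<subseteq> {x. (a + \<eta> *\<^sub>R b) \<bullet> x \<le> c}"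
    by (rule hull_minimal) (use ext in \<open>auto simp: convex_halfspace_le\<close>)
  finally show False
    using tilt[OF \<open>\<eta> > 0\<close>] by fastforce
qed

section \<open>A segment beyond which the convex set reaches\<close>

lemma convex_contains_subconvex_combination:
  assumes "convex K" "0 \<in> K" "u \<in> K" "v \<in> K" "0 \<le> a" "0 \<le> b" "a + b \<le> 1"
  shows "a *\<^sub>R u + b *\<^sub>R v \<in> K"
proof -
  have "a *\<^sub>R u + b *\<^sub>R v + (1 - a - b) *\<^sub>R 0 \<in> convex hull {u, v, 0}"
    unfolding convex_hull_3 mem_Collect_eq
    using assms by (intro exI[of _ a] exI[of _ b] exI[of _ "1 - a - b"]) auto
  moreover have "convex hull {u, v, 0} \<subseteq> K"
    using assms by (intro hull_minimal) auto
  ultimately show ?thesis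
    by auto
qed

text \<open>
  The points \<open>0\<close>, \<open>(r, 0)\<close>, \<open>(t, t)\<close>, \<open>(0, r)\<close> span a convex quadrilateral in which the open
  segment from \<open>(r, 0)\<close> to \<open>(0, r)\<close> is a diagonal. The open set in the proof describes the
  interior of this quadrilateral by the edges through \<open>(t, t)\<close>. On either side of the main
  diagonal, the left-hand side of the relevant edge inequality is the sum of the coefficients of
  the point with respect to \<open>(t, t)\<close> and one of the two ends.
\<close>

lemma interior_convex_beyond_segment:
  fixes K :: "(real \<times> real) set"
  assumes K: "convex K" "0 \<in> K" "(r, 0) \<in> K" "(0, r) \<in> K" "(t, t) \<in> K"
    and r: "0 < r" "r < 2 * t"
    and xy: "0 < x" "0 < y" "x + y = r"
  shows "(x, y) \<in> interior K"
proof (rule interiorI)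
  let ?U = "{p. 0 < fst p} \<inter> {p. 0 < snd p} \<inter>
    {p. fst p / t + (snd p - fst p) / r < 1} \<inter> {p. snd p / t + (fst p - snd p) / r < 1}"
  have "t > 0"
    using r by simp
  show "open ?U"
    using \<open>t > 0\<close> r by (intro open_Int open_Collect_less continuous_intros) auto
  have "1 / t < 2 / r"
    using r \<open>t > 0\<close> by (simp add: divide_simps)
  then have slope: "z * (1 / t - 2 / r) < 0" if "z > 0" for z
    using that by (simp add: mult_pos_neg)
  have "y = r - x"
    using xy by simp
  have "x / t + (y - x) / r = 1 + x * (1 / t - 2 / r)"
       "y / t + (x - y) / r = 1 + y * (1 / t - 2 / r)"
    using r by (simp_all add: \<open>y = r - x\<close> diff_divide_distrib right_diff_distrib)
  then show "(x, y) \<in> ?U"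
    using slope[of x] slope[of y] xy by simp
  show "?U \<subseteq> K"
  proof
    fix p assume p: "p \<in> ?U"
    show "p \<in> K"
    proof (cases "fst p \<le> snd p")
      case True
      have "(fst p / t) *\<^sub>R (t, t) + ((snd p - fst p) / r) *\<^sub>R (0, r) \<in> K"
        by (rule convex_contains_subconvex_combination) (use K p True r \<open>t > 0\<close> in auto)
      also have "(fst p / t) *\<^sub>R (t, t) + ((snd p - fst p) / r) *\<^sub>R (0, r) = p"
        using r \<open>t > 0\<close> by (simp add: prod_eq_iff)
      finally show ?thesis .
    next
      case False
      have "(snd p / t) *\<^sub>R (t, t) + ((fst p - snd p) / r) *\<^sub>R (r, 0) \<in> K"
        by (rule convex_contains_subconvex_combination) (use K p False r \<open>t > 0\<close> in auto)
      also have "(snd p / t) *\<^sub>R (t, t) + ((fst p - snd p) / r) *\<^sub>R (r, 0) = p"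
        using r \<open>t > 0\<close> by (simp add: prod_eq_iff)
      finally show ?thesis .
    qed
  qed
qed

section \<open>The generating points and their distance from the segment\<close>

lemma alpha_nonneg: "0 \<le> alpha \<rho> n"
  by (simp add: alpha_def)

lemma ceiling_eq_alpha: "of_int \<lceil>real n * \<rho>\<rceil> = real n * \<rho> + alpha \<rho> n"
  by (simp add: alpha_def)

text \<open>
  Since \<open>alpha n\<close> is the fractional part of \<open>- n \<rho>\<close>, this is Kronecker's theorem for \<open>- \<rho>\<close>.
\<close>

lemma alpha_dense_below:
  assumes "0 < \<rho>" "\<rho> < 1" "\<rho> \<notin> \<rat>" "c < \<rho>"
  shows "\<exists>n. c < alpha \<rho> n \<and> alpha \<rho> n < \<rho>"
proof -
  define d where "d = max c 0"
  have d: "0 \<le> d" "c \<le> d" "d < \<rho>"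
    using assms by (auto simp: d_def)
  have "- \<rho> \<notin> \<rat>"
    using assms by simp
  then obtain n where n: "\<bar>frac (real n * - \<rho>) - (d + \<rho>) / 2\<bar> < (\<rho> - d) / 2"
    using Kronecker_approx_1_explicit[of "- \<rho>" "(d + \<rho>) / 2" "(\<rho> - d) / 2"] assms d by auto
  have "frac (real n * - \<rho>) = alpha \<rho> n"
    by (simp add: frac_def alpha_def ceiling_def)
  then show ?thesis
    using n d by (intro exI[of _ n]) (auto simp: abs_if field_simps split: if_splits)
qed

lemma rho_pt_sum:
  "fst (rho_pt \<rho> m n) + snd (rho_pt \<rho> m n) - \<rho> = (alpha \<rho> m + alpha \<rho> n - \<rho>) / real (m + n + 1)"
  unfolding rho_pt_def ceiling_eq_alpha by (simp add: divide_simps) (simp add: algebra_simps)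

text \<open>
  Measured at \<open>(\<rho>, 0)\<close>, this is the inclination of the line to \<open>rho_pt m n\<close> relative to the
  segment \<open>x + y = \<rho>\<close>: it is \<open>(x + y - \<rho>) / y\<close> at the point \<open>(x, y)\<close>. The formula in
  terms of \<open>alpha\<close> shows that for fixed \<open>n\<close> it increases with \<open>alpha m\<close>.
\<close>

definition slope :: "real \<Rightarrow> nat \<Rightarrow> nat \<Rightarrow> real" where
  "slope \<rho> m n = (alpha \<rho> m + alpha \<rho> n - \<rho>) / of_int \<lceil>real n * \<rho>\<rceil>"

lemma ceiling_ge_1: "0 < \<rho> \<Longrightarrow> 0 < n \<Longrightarrow> (1::real) \<le> of_int \<lceil>real n * \<rho>\<rceil>"
  by (simp add: one_le_ceiling)

lemma rho_pt_sum_slope: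
  assumes "0 < \<rho>" "0 < n"
  shows "fst (rho_pt \<rho> m n) + snd (rho_pt \<rho> m n) - \<rho> = slope \<rho> m n * snd (rho_pt \<rho> m n)"
proof -
  have "(of_int \<lceil>real n * \<rho>\<rceil> :: real) \<noteq> 0"
    using ceiling_ge_1[OF assms] by linarith
  then show ?thesis
    unfolding rho_pt_sum by (simp add: rho_pt_def slope_def del: of_int_eq_0_iff)
qed

lemma snd_rho_pt_pos: "0 < \<rho> \<Longrightarrow> 0 < n \<Longrightarrow> 0 < snd (rho_pt \<rho> m n)"
  using ceiling_ge_1[of \<rho> n] by (simp add: rho_pt_def)

definition generators :: "real \<Rightarrow> (real \<times> real) set" where
  "generators \<rho> = insert 0 {rho_pt \<rho> m n |m n. alpha \<rho> m < \<rho> \<and> alpha \<rho> n < \<rho>}"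

lemma generators_subset_cbox:
  assumes "0 < \<rho>"
  shows "generators \<rho> \<subseteq> cbox (0, 0) (\<rho>, \<rho>)"
proof -
  have bound: "0 \<le> of_int \<lceil>real m * \<rho>\<rceil> / real (k + m + 1) \<and> of_int \<lceil>real m * \<rho>\<rceil> / real (k + m + 1) \<le> \<rho>"
    if "alpha \<rho> m < \<rho>" for m k
  proof -
    have "of_int \<lceil>real m * \<rho>\<rceil> \<le> (real m + 1) * \<rho>"
      using that unfolding ceiling_eq_alpha by (simp add: algebra_simps)
    also have "\<dots> \<le> real (k + m + 1) * \<rho>"
      using assms by (intro mult_right_mono) auto
    finally have "of_int \<lceil>real m * \<rho>\<rceil> \<le> \<rho> * real (k + m + 1)"
      by (simp only: mult.commute)
    moreover have "(0::real) \<le> of_int \<lceil>real m * \<rho>\<rceil>"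
      using assms alpha_nonneg[of \<rho> m] unfolding ceiling_eq_alpha by simp
    ultimately show ?thesis
      by (simp add: divide_le_eq)
  qed
  have "rho_pt \<rho> m n \<in> cbox (0, 0) (\<rho>, \<rho>)" if "alpha \<rho> m < \<rho>" "alpha \<rho> n < \<rho>" for m n
    using bound[OF that(1), of n] bound[OF that(2), of m]
    by (simp add: rho_pt_def cbox_Pair_eq add.commute[of m n])
  moreover have "(0 :: real \<times> real) \<in> cbox (0, 0) (\<rho>, \<rho>)"
    using assms by (simp add: cbox_Pair_eq zero_prod_def)
  ultimately show ?thesis
    unfolding generators_def by blast
qed

lemma compact_closure_generators: "0 < \<rho> \<Longrightarrow> compact (closure (generators \<rho>))"
  unfolding compact_closure by (rule bounded_subset[OF bounded_cbox generators_subset_cbox])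

lemma Lambda_eq_hull_closure:
  assumes "0 < \<rho>"
  shows "Lambda \<rho> = convex hull (closure (generators \<rho>))"
proof
  have "closed (convex hull (closure (generators \<rho>)))"
    using assms by (intro compact_imp_closed compact_convex_hull compact_closure_generators)
  then show "Lambda \<rho> \<subseteq> convex hull (closure (generators \<rho>))"
    unfolding Lambda_def generators_def[symmetric]
    by (intro closure_minimal hull_mono closure_subset)
  show "convex hull (closure (generators \<rho>)) \<subseteq> Lambda \<rho>"
    unfolding Lambda_def generators_def[symmetric]
    by (intro hull_minimal closure_mono hull_subset convex_closure convex_convex_hull)
qed

text \<open>
  Only finitely many generating points have both indices below \<open>N\<close>. All others lie in the closed
  strip of half-width \<open>\<rho> / (N + 1)\<close> around the line \<open>x + y = \<rho>\<close>, so every limit point lies in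
  all of these strips.
\<close>

lemma limpt_generators_on_segment:
  assumes "0 < \<rho>" and p: "p islimpt generators \<rho>"
  shows "0 \<le> fst p" "0 \<le> snd p" "fst p + snd p = \<rho>"
proof -
  have "p \<in> cbox (0, 0) (\<rho>, \<rho>)"
    using islimpt_subset[OF p generators_subset_cbox[OF assms(1)]] closed_cbox
    by (auto simp: closed_limpt)
  then show "0 \<le> fst p" "0 \<le> snd p"
    by (auto simp: cbox_Pair_eq)
  have near: "\<bar>fst p + snd p - \<rho>\<bar> \<le> \<rho> / real (N + 1)" for N
  proof -
    define F where "F = insert 0 ((\<lambda>(m, n). rho_pt \<rho> m n) ` ({..<N} \<times> {..<N}))"
    let ?S = "{q. \<bar>fst q + snd q - \<rho>\<bar> \<le> \<rho> / real (N + 1)}"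
    have "0 \<in> F"
      by (simp add: F_def)
    have "rho_pt \<rho> m n \<in> F \<union> ?S" if "alpha \<rho> m < \<rho>" "alpha \<rho> n < \<rho>" for m n
    proof (cases "m < N \<and> n < N")
      case True
      then show ?thesis
        by (force simp: F_def)
    next
      case False
      have "\<bar>alpha \<rho> m + alpha \<rho> n - \<rho>\<bar> \<le> \<rho>"
        using that alpha_nonneg[of \<rho> m] alpha_nonneg[of \<rho> n] by (simp add: abs_le_iff)
      then have "\<bar>(alpha \<rho> m + alpha \<rho> n - \<rho>) / real (m + n + 1)\<bar> \<le> \<rho> / real (N + 1)"
        using False assms(1) unfolding abs_divide by (intro frac_le) auto
      then show ?thesis
        by (simp add: rho_pt_sum)
    qed
    then have "generators \<rho> \<subseteq> F \<union> ?S"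
      unfolding generators_def using \<open>0 \<in> F\<close> by blast
    then have "p islimpt F \<union> ?S"
      by (rule islimpt_subset[OF p])
    moreover have "finite F"
      by (simp add: F_def)
    ultimately have "p islimpt ?S"
      by (simp add: islimpt_Un_finite)
    moreover have "closed ?S"
      by (intro closed_Collect_le continuous_intros)
    ultimately show ?thesis
      by (auto simp: closed_limpt)
  qed
  have "(\<lambda>N. \<rho> / real (N + 1)) \<longlonglongrightarrow> 0"
    using LIMSEQ_Suc[OF lim_const_over_n[of \<rho>]] by simp
  then have "\<bar>fst p + snd p - \<rho>\<bar> \<le> 0"
    using near by (intro LIMSEQ_le_const) auto
  then show "fst p + snd p = \<rho>"
    by simp
qed

section \<open>Symmetry of the two coordinates\<close>

lemma swap_rho_pt: "prod.swap (rho_pt \<rho> m n) = rho_pt \<rho> n m"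
  by (simp add: rho_pt_def add.commute)

lemma swap_generators: "prod.swap ` generators \<rho> = generators \<rho>"
proof -
  have "prod.swap ` generators \<rho> \<subseteq> generators \<rho>"
    by (auto simp: generators_def swap_rho_pt zero_prod_def)
  moreover from image_mono[OF this, of prod.swap]
  have "generators \<rho> \<subseteq> prod.swap ` generators \<rho>"
    by (simp add: image_image)
  ultimately show ?thesis
    by blast
qed

lemma linear_swap: "linear (prod.swap :: real \<times> real \<Rightarrow> real \<times> real)"
  by (intro linearI) auto

lemma swap_Lambda: "prod.swap ` Lambda \<rho> = Lambda \<rho>"
  unfolding Lambda_def generators_def[symmetric]
  by (simp add: closure_injective_linear_image linear_swap convex_hull_linear_image
      swap_generators)

lemma swap_extreme_points_Lambda:
  "prod.swap ` {x. x extreme_point_of Lambda \<rho>} = {x. x extreme_point_of Lambda \<rho>}"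
proof -
  have iff: "prod.swap x extreme_point_of Lambda \<rho> \<longleftrightarrow> x extreme_point_of Lambda \<rho>" for x
    using face_of_linear_image[OF linear_swap inj_swap, of "{x}" "Lambda \<rho>"]
    by (simp add: face_of_singleton swap_Lambda)
  show ?thesis
    using iff by (auto simp: image_iff intro: bexI[of _ "prod.swap x" for x])
qed

section \<open>Accumulation points of the extreme points\<close>

context
  fixes \<rho> :: real
  assumes rho: "0 < \<rho>" "\<rho> < 1" "\<rho> \<notin> \<rat>"
begin

lemma exists_diagonal_beyond:
  obtains m where "0 < m" "\<rho> / 2 < alpha \<rho> m" "alpha \<rho> m < \<rho>"
proof -
  obtain m where m: "\<rho> / 2 < alpha \<rho> m" "alpha \<rho> m < \<rho>"
    using alpha_dense_below[OF rho, of "\<rho> / 2"] rho by auto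
  moreover have "0 < m"
    using m rho by (cases "m = 0") (auto simp: alpha_def)
  ultimately show ?thesis
    using that by blast
qed

text \<open>
  The points \<open>rho_pt m 0\<close> lie on the \<open>x\<close>-axis, at distance at most \<open>\<rho> - alpha m\<close> from
  \<open>(\<rho>, 0)\<close>.
\<close>

lemma right_end_mem_Lambda: "(\<rho>, 0) \<in> Lambda \<rho>"
proof -
  have "(\<rho>, 0) \<in> closure (generators \<rho>)"
    unfolding closure_approachable
  proof (intro allI impI)
    fix e :: real assume "e > 0"
    then obtain m where m: "\<rho> - e < alpha \<rho> m" "alpha \<rho> m < \<rho>"
      using alpha_dense_below[OF rho, of "\<rho> - e"] by auto
    have "fst (rho_pt \<rho> m 0) - \<rho> = (alpha \<rho> m - \<rho>) / real (m + 1)"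
      using rho_pt_sum[of \<rho> m 0] by (simp add: rho_pt_def alpha_def)
    also have "\<bar>\<dots>\<bar> = (\<rho> - alpha \<rho> m) / real (m + 1)"
      using m by simp
    also have "\<dots> \<le> (\<rho> - alpha \<rho> m) / 1"
      using m by (intro divide_left_mono) auto
    finally have "dist (rho_pt \<rho> m 0) (\<rho>, 0) < e"
      using m by (simp add: dist_prod_def dist_real_def rho_pt_def)
    moreover have "alpha \<rho> 0 < \<rho>"
      using rho by (simp add: alpha_def)
    then have "rho_pt \<rho> m 0 \<in> generators \<rho>"
      using m by (auto simp: generators_def)
    ultimately show "\<exists>y\<in>generators \<rho>. dist y (\<rho>, 0) < e"
      by blast
  qed
  then show ?thesis
    using rho by (simp add: Lambda_eq_hull_closure hull_inc)
qed

lemma open_segment_subset_interior_Lambda: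
  assumes "0 < x" "0 < y" "x + y = \<rho>"
  shows "(x, y) \<in> interior (Lambda \<rho>)"
proof -
  obtain m where m: "\<rho> / 2 < alpha \<rho> m" "alpha \<rho> m < \<rho>"
    using exists_diagonal_beyond by blast
  define t where "t = fst (rho_pt \<rho> m m)"
  have t: "rho_pt \<rho> m m = (t, t)"
    by (simp add: t_def rho_pt_def)
  have "0 < (alpha \<rho> m + alpha \<rho> m - \<rho>) / real (m + m + 1)"
    using m by simp
  then have "\<rho> < 2 * t"
    using rho_pt_sum[of \<rho> m m] t by simp
  moreover have "convex (Lambda \<rho>)"
    using rho by (simp add: Lambda_eq_hull_closure)
  moreover have "generators \<rho> \<subseteq> Lambda \<rho>"
    using rho by (simp add: Lambda_eq_hull_closure closure_subset hull_subset subset_trans[OF closure_subset])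
  moreover have "0 \<in> generators \<rho>" "(t, t) \<in> generators \<rho>"
    using m t[symmetric] by (auto simp: generators_def)
  moreover have "(0, \<rho>) \<in> Lambda \<rho>"
    using imageI[OF right_end_mem_Lambda, of prod.swap] by (simp add: swap_Lambda)
  ultimately show ?thesis
    using interior_convex_beyond_segment[of "Lambda \<rho>" \<rho> t x y] right_end_mem_Lambda rho assms
    by blast
qed

lemma islimpt_extreme_points_Lambda_imp_end:
  assumes p: "p islimpt {x. x extreme_point_of Lambda \<rho>}"
  shows "p = (0, \<rho>) \<or> p = (\<rho>, 0)"
proof -
  have "{x. x extreme_point_of Lambda \<rho>} \<subseteq> closure (generators \<rho>)"
    using rho(1) by (simp add: Lambda_eq_hull_closure extreme_points_of_convex_hull)
  then have "p islimpt generators \<rho>"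
    using islimpt_subset[OF p] limpt_of_closure[THEN iffD1] by auto
  note seg = limpt_generators_on_segment[OF rho(1) this]
  have "{x. x extreme_point_of Lambda \<rho>} \<subseteq> - interior (Lambda \<rho>)"
    using extreme_point_not_in_interior by blast
  then have "p islimpt - interior (Lambda \<rho>)"
    by (rule islimpt_subset[OF p])
  then have "p \<in> - interior (Lambda \<rho>)"
    using closed_limpt[of "- interior (Lambda \<rho>)"] by (cases p) (auto simp: closed_Compl)
  then have "fst p = 0 \<or> snd p = 0"
    using open_segment_subset_interior_Lambda[of "fst p" "snd p"] seg by force
  then show ?thesis
    using seg by (auto simp: prod_eq_iff)
qed

text \<open>
  The numerator of a slope is below \<open>\<rho>\<close> and its denominator is at least 1, so the supremum
  exists. It is positive because of a diagonal point beyond the segment, and it is not attained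
  because \<open>alpha m\<close> can always be replaced by a larger value below \<open>\<rho>\<close>.
\<close>

lemma slope_sup:
  obtains \<sigma> where "0 < \<sigma>"
    and "\<And>m n. alpha \<rho> m < \<rho> \<Longrightarrow> alpha \<rho> n < \<rho> \<Longrightarrow> 0 < n \<Longrightarrow> slope \<rho> m n < \<sigma>"
    and "\<And>s. s < \<sigma> \<Longrightarrow> \<exists>m n. alpha \<rho> m < \<rho> \<and> alpha \<rho> n < \<rho> \<and> 0 < n \<and> s < slope \<rho> m n"
proof -
  define P where "P = {(m, n). alpha \<rho> m < \<rho> \<and> alpha \<rho> n < \<rho> \<and> 0 < n}"
  define S where "S = (\<lambda>(m, n). slope \<rho> m n) ` P"
  have mono: "slope \<rho> m n < slope \<rho> k n" if "alpha \<rho> m < alpha \<rho> k" "0 < n" for m k n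
    using that ceiling_ge_1[OF rho(1) that(2)] by (auto simp: slope_def intro!: divide_strict_right_mono)
  have "slope \<rho> m n \<le> \<rho>" if "(m, n) \<in> P" for m n
  proof -
    have "slope \<rho> m n \<le> \<rho> / of_int \<lceil>real n * \<rho>\<rceil>"
      unfolding slope_def
      using that ceiling_ge_1[OF rho(1), of n] by (intro divide_right_mono) (auto simp: P_def)
    also have "\<dots> \<le> \<rho>"
      using that ceiling_ge_1[OF rho(1), of n] rho by (simp add: P_def divide_le_eq)
    finally show ?thesis .
  qed
  then have bdd: "bdd_above S"
    by (intro bdd_aboveI[of _ \<rho>]) (auto simp: S_def)
  have below: "slope \<rho> m n < Sup S" if "alpha \<rho> m < \<rho>" "alpha \<rho> n < \<rho>" "0 < n" for m n
  proof -
    obtain k where k: "alpha \<rho> m < alpha \<rho> k" "alpha \<rho> k < \<rho>"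
      using alpha_dense_below[OF rho \<open>alpha \<rho> m < \<rho>\<close>] by blast
    have "slope \<rho> m n < slope \<rho> k n"
      using mono k that by blast
    also have "slope \<rho> k n \<le> Sup S"
      using k that bdd by (intro cSup_upper) (auto simp: S_def P_def)
    finally show ?thesis .
  qed
  obtain m where m: "0 < m" "\<rho> / 2 < alpha \<rho> m" "alpha \<rho> m < \<rho>"
    by (rule exists_diagonal_beyond)
  have "0 < slope \<rho> m m"
    using m ceiling_ge_1[OF rho(1), of m] by (simp add: slope_def)
  then have "0 < Sup S"
    using below[of m m] m by simp
  moreover have "\<exists>m n. alpha \<rho> m < \<rho> \<and> alpha \<rho> n < \<rho> \<and> 0 < n \<and> s < slope \<rho> m n" if "s < Sup S" for s
  proof -
    have "S \<noteq> {}"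
      using m by (auto simp: S_def P_def)
    then show ?thesis
      using less_cSupD[OF _ that] by (auto simp: S_def P_def)
  qed
  ultimately show ?thesis
    using that below by blast
qed

text \<open>
  The line of slope \<open>\<sigma>\<close> is pivoted at \<open>(\<rho>, 0)\<close>. Each kind of point of the closure stays
  strictly below it for its own reason: points with \<open>n = 0\<close> because \<open>alpha m < \<rho>\<close>, those with
  \<open>n > 0\<close> because \<open>\<sigma>\<close> is not attained, and limit points on the segment because \<open>\<sigma> > 0\<close>.
\<close>

lemma right_end_islimpt_extreme_points: "(\<rho>, 0) islimpt {x. x extreme_point_of Lambda \<rho>}"
proof -
  obtain \<sigma> where \<sigma>: "0 < \<sigma>"
    and below: "\<And>m n. alpha \<rho> m < \<rho> \<Longrightarrow> alpha \<rho> n < \<rho> \<Longrightarrow> 0 < n \<Longrightarrow> slope \<rho> m n < \<sigma>"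
    and approx: "\<And>s. s < \<sigma> \<Longrightarrow> \<exists>m n. alpha \<rho> m < \<rho> \<and> alpha \<rho> n < \<rho> \<and> 0 < n \<and> s < slope \<rho> m n"
    by (rule slope_sup) blast
  have "(\<rho>, 0) islimpt {x. x extreme_point_of (convex hull (closure (generators \<rho>)))}"
  proof (rule islimpt_extreme_points_by_tilting[where a = "(1, 1 - \<sigma>)" and b = "(0, 1)" and c = \<rho>])
    show "compact (closure (generators \<rho>))"
      using rho(1) by (rule compact_closure_generators)
  next
    fix p assume p: "p \<in> closure (generators \<rho>)" "p \<noteq> (\<rho>, 0)"
    have "fst p + snd p - \<rho> < \<sigma> * snd p"
    proof (cases "p \<in> generators \<rho>")
      case False
      then have "p islimpt generators \<rho>"
        using p by (simp add: closure_def)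
      note seg = limpt_generators_on_segment[OF rho(1) this]
      then have "0 < snd p"
        using p(2) by (cases "snd p = 0") (auto simp: prod_eq_iff)
      then show ?thesis
        using seg \<sigma> by simp
    next
      case True
      then consider "p = 0" | m n where "p = rho_pt \<rho> m n" "alpha \<rho> m < \<rho>" "alpha \<rho> n < \<rho>"
        by (auto simp: generators_def)
      then show ?thesis
      proof cases
        case 1
        then show ?thesis
          using rho by simp
      next
        case (2 m n)
        show ?thesis
        proof (cases "n = 0")
          case True
          then have "fst p + snd p - \<rho> = (alpha \<rho> m - \<rho>) / real (m + 1)" "snd p = 0"
            using 2 rho_pt_sum[of \<rho> m 0] by (auto simp: alpha_def rho_pt_def)
          then show ?thesis
            using 2 by (simp add: divide_less_0_iff)
        next
          case False
          then have "fst p + snd p - \<rho> = slope \<rho> m n * snd p" "0 < snd p"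
            using 2 rho rho_pt_sum_slope snd_rho_pt_pos by auto
          then show ?thesis
            using below[of m n] 2 False by simp
        qed
      qed
    qed
    then show "(1, 1 - \<sigma>) \<bullet> p < \<rho>"
      by (simp add: inner_prod_def algebra_simps)
  next
    fix \<eta> :: real assume "\<eta> > 0"
    then obtain m n where mn: "alpha \<rho> m < \<rho>" "alpha \<rho> n < \<rho>" "0 < n" "\<sigma> - \<eta> < slope \<rho> m n"
      using approx[of "\<sigma> - \<eta>"] by auto
    let ?p = "rho_pt \<rho> m n"
    have "(\<sigma> - \<eta>) * snd ?p < slope \<rho> m n * snd ?p"
      using mn rho snd_rho_pt_pos by (intro mult_strict_right_mono)
    then have "\<rho> < ((1, 1 - \<sigma>) + \<eta> *\<^sub>R (0, 1)) \<bullet> ?p"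
      using rho_pt_sum_slope[OF rho(1) \<open>0 < n\<close>, of m] by (simp add: inner_prod_def algebra_simps)
    moreover have "?p \<in> closure (generators \<rho>)"
      using mn closure_subset by (fastforce simp: generators_def)
    ultimately show "\<exists>x\<in>closure (generators \<rho>). \<rho> < ((1, 1 - \<sigma>) + \<eta> *\<^sub>R (0, 1)) \<bullet> x"
      by blast
  qed auto
  then show ?thesis
    using rho by (simp add: Lambda_eq_hull_closure)
qed

lemma left_end_islimpt_extreme_points: "(0, \<rho>) islimpt {x. x extreme_point_of Lambda \<rho>}"
proof -
  have "isCont prod.swap (\<rho>, 0)"
    unfolding prod.swap_def by (intro continuous_intros)
  moreover have "eventually (\<lambda>y. prod.swap y \<noteq> prod.swap (\<rho>, 0)) (at (\<rho>, 0))"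
    unfolding eventually_at_filter by (rule always_eventually) auto
  ultimately show ?thesis
    using islimpt_isCont_image[OF right_end_islimpt_extreme_points, of prod.swap]
    by (simp add: swap_extreme_points_Lambda)
qed

end

theorem proposition2:
  fixes \<rho> :: real
  assumes "0 < \<rho>" and "\<rho> < 1" and "\<rho> \<notin> \<rat>"
  shows "infinite {x. x extreme_point_of Lambda \<rho>} \<and>
    {p. p islimpt {x. x extreme_point_of Lambda \<rho>}} = {(0, \<rho>), (\<rho>, 0)}"
proof
  show "infinite {x. x extreme_point_of Lambda \<rho>}"
    using right_end_islimpt_extreme_points[OF assms] islimpt_finite by blast
  show "{p. p islimpt {x. x extreme_point_of Lambda \<rho>}} = {(0, \<rho>), (\<rho>, 0)}"
    using islimpt_extreme_points_Lambda_imp_end[OF assms] right_end_islimpt_extreme_points[OF assms]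
      left_end_islimpt_extreme_points[OF assms] by auto
qed

end
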